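(* Let $\mathcal{H}_d$ be a $d$-dimensional complex Hilbert space, let $A\in L(\mathcal{H}_d)$, $m\in\mathbb{N}\setminus\{0\}$, $f_1,\ldots,f_m\in\mathcal{H}_d$, and set $\mathcal{F}:=\operatorname{span}\{f_1,\ldots,f_m\}$. Moreover, for each $\lambda\in\sigma(A)$ choose a subspace $V_\lambda$ such that $\mathcal{H}_d=V_\lambda\dotplus\operatorname{ran}(A-\lambda)$ and denote the projection onto $V_\lambda$ with respect to this decomposition by $Q_{V_\lambda}$. Then the following statements are equivalent: (i) The system $(A^nf_i)_{n\in\{0,\ldots,d-1\},\,i\in\{1,\ldots,m\}}$ is a frame for $\mathcal{H}_d$ (equivalently, complete in $\mathcal{H}_d$). (ii) For each $\lambda\in\sigma(A)$ we have $Q_{V_\lambda}\mathcal{F}=V_\lambda$. (iii) For each $\lambda\in\sigma(A^* )$ we have $P_{\ker(A^*-\lambda)}\mathcal{F}=\ker(A^*-\lambda)$.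
   Context: $\mathbb{N}=\{0,1,2,\dots\}$. $L(\mathcal{H}_d)$ is the set of linear operators on $\mathcal{H}_d$; $\sigma(A)$ is the spectrum (set of eigenvalues) of $A$; $A-\lambda:=A-\lambda\,\mathrm{Id}$; $\operatorname{ran}$ and $\ker$ denote range and kernel. $P_M$ denotes the orthogonal projection in $\mathcal{H}_d$ onto the subspace $M$, and $\dotplus$ denotes a direct (not necessarily orthogonal) sum of subspaces. *)

theory Defs
  imports "HOL-Analysis.Analysis"
begin

class scaleC =
  fixes scaleC :: "complex \<Rightarrow> 'a \<Rightarrow> 'a"  (infixr \<open>*\<^sub>C\<close> 75)

class cinner =
  fixes cinner :: "'a \<Rightarrow> 'a \<Rightarrow> complex"

text \<open>Complex Hilbert spaces, with the inner product linear in its first argument. The superclass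
  \<open>banach\<close> supplies completeness, the norm and the topology; the last two axioms tie its norm and
  its real scalar multiplication to the complex structure.\<close>

class complex_hilbert = banach + scaleC + cinner +
  assumes scaleC_add_right: "a *\<^sub>C (x + y) = a *\<^sub>C x + a *\<^sub>C y"
    and scaleC_add_left: "(a + b) *\<^sub>C x = a *\<^sub>C x + b *\<^sub>C x"
    and scaleC_scaleC: "a *\<^sub>C b *\<^sub>C x = (a * b) *\<^sub>C x"
    and scaleC_one: "1 *\<^sub>C x = x"
    and cinner_commute: "cinner x y = cnj (cinner y x)"
    and cinner_add_left: "cinner (x + y) z = cinner x z + cinner y z"
    and cinner_scaleC_left: "cinner (a *\<^sub>C x) y = a * cinner x y"
    and scaleR_scaleC: "r *\<^sub>R x = complex_of_real r *\<^sub>C x"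
    and norm_eq_sqrt_cinner: "norm x = sqrt (Re (cinner x x))"

global_interpretation complex_vector: vector_space "scaleC :: complex \<Rightarrow> 'a \<Rightarrow> 'a::complex_hilbert"
  defines cspan = complex_vector.span
    and csubspace = complex_vector.subspace
    and cdependent = complex_vector.dependent
  by unfold_locales
    (simp_all add: scaleC_add_right scaleC_add_left scaleC_scaleC scaleC_one)

abbreviation clinear :: "('a::complex_hilbert \<Rightarrow> 'a) \<Rightarrow> bool" where
  "clinear \<equiv> Vector_Spaces.linear scaleC scaleC"

definition cadjoint :: "('a::complex_hilbert \<Rightarrow> 'a) \<Rightarrow> 'a \<Rightarrow> 'a" where
  "cadjoint A = (THE B. \<forall>x y. cinner (A x) y = cinner x (B y))"

definition minus_scalar :: "('a::complex_hilbert \<Rightarrow> 'a) \<Rightarrow> complex \<Rightarrow> 'a \<Rightarrow> 'a" where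
  "minus_scalar A c = (\<lambda>x. A x - c *\<^sub>C x)"

definition ker :: "('a::complex_hilbert \<Rightarrow> 'a) \<Rightarrow> 'a set" where
  "ker A = {x. A x = 0}"

definition cspectrum :: "('a::complex_hilbert \<Rightarrow> 'a) \<Rightarrow> complex set" where
  "cspectrum A = {c. \<exists>x. x \<noteq> 0 \<and> A x = c *\<^sub>C x}"

definition is_direct_sum :: "'a::complex_hilbert set \<Rightarrow> 'a set \<Rightarrow> bool" where
  "is_direct_sum V W \<longleftrightarrow>
     csubspace V \<and> csubspace W \<and> V \<inter> W = {0} \<and> {v + w | v w. v \<in> V \<and> w \<in> W} = UNIV"

text \<open>The projection onto \<open>V\<close> along \<open>W\<close>; meaningful only if \<open>is_direct_sum V W\<close>.\<close>

definition proj_along :: "'a::complex_hilbert set \<Rightarrow> 'a set \<Rightarrow> 'a \<Rightarrow> 'a" where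
  "proj_along V W x = (THE v. v \<in> V \<and> x - v \<in> W)"

definition orth_compl :: "'a::complex_hilbert set \<Rightarrow> 'a set" where
  "orth_compl M = {x. \<forall>y\<in>M. cinner x y = 0}"

definition orth_proj :: "'a::complex_hilbert set \<Rightarrow> 'a \<Rightarrow> 'a" where
  "orth_proj M = proj_along M (orth_compl M)"

text \<open>Frames and completeness are properties of indexed systems \<open>(\<phi> i)\<^sub>i\<^sub>\<in>\<^sub>I\<close>, so a repeated
  vector counts with multiplicity.\<close>

definition is_frame :: "('i \<Rightarrow> 'a::complex_hilbert) \<Rightarrow> 'i set \<Rightarrow> bool" where
  "is_frame \<phi> I \<longleftrightarrow>
     (\<exists>\<alpha>>0. \<exists>\<beta>>0. \<forall>x. (\<lambda>i. (cmod (cinner x (\<phi> i)))\<^sup>2) summable_on I \<and>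
        \<alpha> * (norm x)\<^sup>2 \<le> (\<Sum>\<^sub>\<infinity>i\<in>I. (cmod (cinner x (\<phi> i)))\<^sup>2) \<and>
        (\<Sum>\<^sub>\<infinity>i\<in>I. (cmod (cinner x (\<phi> i)))\<^sup>2) \<le> \<beta> * (norm x)\<^sup>2)"

definition is_complete_system :: "('i \<Rightarrow> 'a::complex_hilbert) \<Rightarrow> 'i set \<Rightarrow> bool" where
  "is_complete_system \<phi> I \<longleftrightarrow> closure (cspan (\<phi> ` I)) = UNIV"

end

theory Submission
  imports Defs "HOL-Computational_Algebra.Fundamental_Theorem_Algebra"
begin

text \<open>All three conditions are compared with one: for every eigenvalue \<open>l\<close> of \<open>A\<close>,
  \<open>F + ran (A - l)\<close> is the whole space.

  Condition (ii) at \<open>l\<close> says this directly, because for any complement \<open>V\<close> of a subspace \<open>W\<close> the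
  projection along \<open>W\<close> maps \<open>F\<close> onto \<open>V\<close> exactly if \<open>F + W\<close> is everything
  (\<open>proj_along_image_eq_iff\<close>). Condition (iii) is the special case of (ii) for one particular
  complement: \<open>ker (A* - cnj l)\<close> is the orthogonal complement of \<open>ran (A - l)\<close>, and the eigenvalues
  of \<open>A*\<close> are the conjugates of those of \<open>A\<close>.

  A finite system in a finite-dimensional space is a frame exactly if it spans, and likewise it is
  complete exactly if it spans; so (i) says that the Krylov subspace \<open>K\<close> generated by \<open>F\<close> with the
  powers \<open>A^0, ..., A^(d-1)\<close> is everything (\<open>krylov_eq_UNIV_iff\<close> relates this to the common
  condition). Since the Krylov subspaces increase strictly until they become stationary, \<open>K\<close>
  already contains all powers of \<open>A\<close> applied to \<open>F\<close> and is therefore \<open>A\<close>-invariant. If \<open>K\<close> is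
  everything, then so is \<open>F + ran (A - l)\<close>, which is an \<open>A\<close>-invariant subspace containing \<open>F\<close>.
  If \<open>K\<close> is proper, its orthogonal complement is a nonzero \<open>A*\<close>-invariant subspace and contains an
  eigenvector of \<open>A*\<close>, for an eigenvalue \<open>cnj l\<close> say. This vector is orthogonal to \<open>F\<close> and to
  \<open>ran (A - l)\<close>, so that \<open>F + ran (A - l)\<close> is proper for an eigenvalue \<open>l\<close> of \<open>A\<close>.\<close>

section \<open>Elementary properties of the inner product\<close>

lemma cinner_add_right:
  fixes x :: "'a::complex_hilbert"
  shows "cinner x (y + z) = cinner x y + cinner x z"
  unfolding cinner_commute[of x "y + z"] cinner_commute[of x y] cinner_commute[of x z]
  by (simp add: cinner_add_left)

lemma cinner_scaleC_right:
  fixes x :: "'a::complex_hilbert"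
  shows "cinner x (a *\<^sub>C y) = cnj a * cinner x y"
  unfolding cinner_commute[of x "a *\<^sub>C y"] cinner_commute[of x y]
  by (simp add: cinner_scaleC_left)

lemma cinner_zero_left [simp]:
  fixes x :: "'a::complex_hilbert"
  shows "cinner 0 x = 0"
  using cinner_add_left[of 0 0 x] by simp

lemma cinner_zero_right [simp]:
  fixes x :: "'a::complex_hilbert"
  shows "cinner x 0 = 0"
  using cinner_add_right[of x 0 0] by simp

lemma cinner_diff_left:
  fixes x :: "'a::complex_hilbert"
  shows "cinner (x - y) z = cinner x z - cinner y z"
  using cinner_add_left[of "x - y" y z] by simp

lemma cinner_diff_right:
  fixes x :: "'a::complex_hilbert"
  shows "cinner x (y - z) = cinner x y - cinner x z"
  using cinner_add_right[of x "y - z" z] by simp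

lemma cinner_sum_left:
  fixes y :: "'a::complex_hilbert"
  shows "cinner (\<Sum>i\<in>S. g i) y = (\<Sum>i\<in>S. cinner (g i) y)"
  by (induction S rule: infinite_finite_induct) (simp_all add: cinner_add_left)

lemma cinner_sum_right:
  fixes x :: "'a::complex_hilbert"
  shows "cinner x (\<Sum>i\<in>S. g i) = (\<Sum>i\<in>S. cinner x (g i))"
  by (induction S rule: infinite_finite_induct) (simp_all add: cinner_add_right)

lemma cinner_eq_0_commute:
  fixes x :: "'a::complex_hilbert"
  shows "cinner x y = 0 \<longleftrightarrow> cinner y x = 0"
  unfolding cinner_commute[of x y] by simp

text \<open>The axioms give the norm only as \<open>sqrt (Re (cinner x x))\<close>. That the real part is nonnegative
  follows from the norm being nonnegative, since the real square root is odd.\<close>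

lemma cinner_self:
  fixes x :: "'a::complex_hilbert"
  shows "cinner x x = complex_of_real ((norm x)\<^sup>2)"
proof -
  have "0 \<le> Re (cinner x x)"
    using norm_ge_zero[of x] unfolding norm_eq_sqrt_cinner[of x] real_sqrt_ge_0_iff .
  then have "(norm x)\<^sup>2 = Re (cinner x x)"
    by (simp add: norm_eq_sqrt_cinner)
  moreover have "Im (cinner x x) = 0"
    using arg_cong[OF cinner_commute[of x x], of Im] by simp
  ultimately show ?thesis
    by (simp add: complex_eq_iff)
qed

lemma cinner_self_eq_0 [simp]:
  fixes x :: "'a::complex_hilbert"
  shows "cinner x x = 0 \<longleftrightarrow> x = 0"
  by (simp add: cinner_self)

lemma norm_scaleC: "norm (c *\<^sub>C y) = cmod c * norm (y::'a::complex_hilbert)"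
proof -
  have "cinner (c *\<^sub>C y) (c *\<^sub>C y) = c * cnj c * cinner y y"
    by (simp add: cinner_scaleC_left cinner_scaleC_right)
  then have "complex_of_real ((norm (c *\<^sub>C y))\<^sup>2)
      = complex_of_real ((cmod c)\<^sup>2 * (norm y)\<^sup>2)"
    by (simp only: cinner_self of_real_mult complex_norm_square)
  then have "(norm (c *\<^sub>C y))\<^sup>2 = (cmod c * norm y)\<^sup>2"
    unfolding of_real_eq_iff power_mult_distrib .
  then show ?thesis
    by (rule power2_eq_imp_eq) simp_all
qed

lemma norm_add_orthogonal:
  fixes x :: "'a::complex_hilbert"
  assumes "cinner x y = 0"
  shows "(norm (x + y))\<^sup>2 = (norm x)\<^sup>2 + (norm y)\<^sup>2"
proof -
  have "cinner (x + y) (x + y) = cinner x x + cinner y y"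
    using assms cinner_eq_0_commute[of x y] by (simp add: cinner_add_left cinner_add_right)
  then have "complex_of_real ((norm (x + y))\<^sup>2) = complex_of_real ((norm x)\<^sup>2 + (norm y)\<^sup>2)"
    by (simp only: cinner_self of_real_add)
  then show ?thesis
    unfolding of_real_eq_iff .
qed

text \<open>Cauchy-Schwarz: the component \<open>c *\<^sub>C y\<close> of \<open>x\<close> along \<open>y\<close> is no longer than \<open>x\<close>, by the theorem
  of Pythagoras.\<close>

lemma cmod_cinner_le:
  fixes x :: "'a::complex_hilbert"
  shows "cmod (cinner x y) \<le> norm x * norm y"
proof (cases "y = 0")
  case False
  define c where "c = cinner x y / cinner y y"
  have "cinner (x - c *\<^sub>C y) (c *\<^sub>C y) = 0"
    using False
    by (simp add: cinner_scaleC_right cinner_scaleC_left cinner_diff_left c_def)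
  from norm_add_orthogonal[OF this]
  have "(norm (c *\<^sub>C y))\<^sup>2 \<le> (norm x)\<^sup>2"
    by simp
  then have "norm (c *\<^sub>C y) \<le> norm x"
    by (rule power2_le_imp_le) simp
  moreover have "norm (c *\<^sub>C y) = cmod (cinner x y) / norm y"
    using False
    by (simp add: norm_scaleC c_def norm_divide cinner_self norm_mult power2_eq_square)
  ultimately show ?thesis
    using False by (simp add: divide_simps)
qed simp

section \<open>Orthonormal systems\<close>

definition orthonormal :: "'a::complex_hilbert set \<Rightarrow> bool" where
  "orthonormal E \<longleftrightarrow> (\<forall>e\<in>E. \<forall>e'\<in>E. cinner e e' = (if e = e' then 1 else 0))"

lemma csubspace_orth_compl: "csubspace (orth_compl M)"
  unfolding orth_compl_def
  by (rule complex_vector.subspaceI) (auto simp: cinner_add_left cinner_scaleC_left)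

lemma orth_compl_cspan: "orth_compl (cspan S) = orth_compl S"
proof
  show "orth_compl (cspan S) \<subseteq> orth_compl S"
    using complex_vector.span_base by (fastforce simp: orth_compl_def)
next
  show "orth_compl S \<subseteq> orth_compl (cspan S)"
  proof
    fix x assume x: "x \<in> orth_compl S"
    have "csubspace {y. cinner x y = 0}"
      by (rule complex_vector.subspaceI) (auto simp: cinner_add_right cinner_scaleC_right)
    then have "cspan S \<subseteq> {y. cinner x y = 0}"
      by (rule complex_vector.span_minimal[rotated]) (use x in \<open>auto simp: orth_compl_def\<close>)
    then show "x \<in> orth_compl (cspan S)"
      by (auto simp: orth_compl_def)
  qed
qed

text \<open>The sum is the orthogonal projection of \<open>x\<close> onto the span of \<open>E\<close>.\<close>

lemma diff_expansion_in_orth_compl: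
  assumes "finite E" "orthonormal E"
  shows "x - (\<Sum>e\<in>E. cinner x e *\<^sub>C e) \<in> orth_compl (cspan E)"
proof -
  have "cinner (x - (\<Sum>e\<in>E. cinner x e *\<^sub>C e)) y = 0" if "y \<in> E" for y
  proof -
    have "cinner (\<Sum>e\<in>E. cinner x e *\<^sub>C e) y = (\<Sum>e\<in>E. if e = y then cinner x e else 0)"
      unfolding cinner_sum_left
      by (rule sum.cong)
        (use assms(2) \<open>y \<in> E\<close> in \<open>auto simp: orthonormal_def cinner_scaleC_left\<close>)
    then show ?thesis
      using assms(1) \<open>y \<in> E\<close> by (simp add: cinner_diff_left)
  qed
  then show ?thesis
    unfolding orth_compl_cspan by (simp add: orth_compl_def)
qed

text \<open>One Gram-Schmidt step per vector: subtract from the new vector its projection onto the span so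
  far, and normalise what remains unless it is zero.\<close>

lemma ex_orthonormal_spanning:
  assumes "finite S"
  shows "\<exists>E. finite E \<and> orthonormal E \<and> cspan E = cspan S"
  using assms
proof induction
  case empty
  show ?case by (intro exI[of _ "{}"]) (simp add: orthonormal_def)
next
  case (insert a S)
  then obtain E where E: "finite E" "orthonormal E" "cspan E = cspan S"
    by blast
  define p where "p = (\<Sum>e\<in>E. cinner a e *\<^sub>C e)"
  define w where "w = a - p"
  have p: "p \<in> cspan E"
    unfolding p_def
    by (intro complex_vector.span_sum complex_vector.span_scale complex_vector.span_base)
  have w: "w \<in> orth_compl (cspan E)"
    using diff_expansion_in_orth_compl[OF E(1,2)] by (simp add: w_def p_def)
  have span_w: "cspan (insert w E) = cspan (insert a S)"
  proof -
    have "cspan (insert w E) = cspan (insert a E)"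
      using complex_vector.eq_span_insert_eq[of a w E] p by (simp add: w_def)
    also have "\<dots> = cspan (insert a S)"
      using E(3) by (simp add: complex_vector.span_insert)
    finally show ?thesis .
  qed
  show ?case
  proof (cases "w = 0")
    case True
    then have "cspan E = cspan (insert a S)"
      using span_w by (simp add: complex_vector.span_insert_0)
    then show ?thesis
      using E by blast
  next
    case False
    define u where "u = complex_of_real (inverse (norm w)) *\<^sub>C w"
    have uE: "cinner u e = 0" "cinner e u = 0" if "e \<in> E" for e
      using w complex_vector.span_base[OF that] cinner_eq_0_commute
      by (auto simp: orth_compl_def u_def cinner_scaleC_left cinner_scaleC_right)
    have uu: "cinner u u = 1"
      using False by (simp add: u_def cinner_self norm_scaleC norm_inverse)
    have "orthonormal (insert u E)"
      using E(2) uE uu by (auto simp: orthonormal_def)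
    moreover have "cspan (insert u E) = cspan (insert w E)"
    proof -
      have "w = complex_of_real (norm w) *\<^sub>C u"
        using False by (simp add: u_def scaleC_scaleC scaleC_one)
      moreover have "complex_of_real (norm w) *\<^sub>C u \<in> cspan (insert u E)"
        by (intro complex_vector.span_scale complex_vector.span_base) simp
      ultimately have "w \<in> cspan (insert u E)"
        by simp
      moreover have "u \<in> cspan (insert w E)"
        unfolding u_def by (intro complex_vector.span_scale complex_vector.span_base) simp
      moreover have "E \<subseteq> cspan (insert v E)" for v
        using complex_vector.span_superset[of "insert v E"] by simp
      ultimately show ?thesis
        unfolding complex_vector.span_eq by simp
    qed
    ultimately show ?thesis
      using E(1) span_w by (intro exI[of _ "insert u E"]) simp
  qed
qed

locale finite_dim_hilbert =
  fixes B :: "'a::complex_hilbert set"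
  assumes finite_basis: "finite B"
    and independent_basis: "\<not> cdependent B"
    and span_basis: "cspan B = UNIV"
begin

sublocale finite_dimensional_vector_space "scaleC :: complex \<Rightarrow> 'a \<Rightarrow> 'a" B
  rewrites "module.span (*\<^sub>C) = (cspan :: 'a set \<Rightarrow> 'a set)"
    and "module.subspace (*\<^sub>C) = (csubspace :: 'a set \<Rightarrow> bool)"
    and "module.dependent (*\<^sub>C) = (cdependent :: 'a set \<Rightarrow> bool)"
proof -
  show "finite_dimensional_vector_space ((*\<^sub>C) :: complex \<Rightarrow> 'a \<Rightarrow> 'a) B"
    using finite_basis independent_basis span_basis
    unfolding cdependent_def cspan_def
    by (intro finite_dimensional_vector_space.intro complex_vector.vector_space_axioms
        finite_dimensional_vector_space_axioms.intro)
qed (unfold cspan_def csubspace_def cdependent_def, (rule refl)+)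

lemma ex_orthonormal_basis:
  fixes M :: "'a set"
  assumes "csubspace M"
  obtains E where "finite E" "orthonormal E" "cspan E = M"
proof -
  obtain S where S: "S \<subseteq> M" "\<not> cdependent S" "M \<subseteq> cspan S"
    using complex_vector.maximal_independent_subset[of M] .
  then have "cspan S = M"
    using complex_vector.span_minimal[OF S(1) assms] by blast
  then show thesis
    using ex_orthonormal_spanning[OF finiteI_independent[OF S(2)]] that by auto
qed

end

section \<open>Orthogonal complements and the adjoint\<close>

lemma is_direct_sumE:
  assumes "is_direct_sum V W"
  obtains v w where "x = v + w" "v \<in> V" "w \<in> W"
proof -
  have "x \<in> {v + w | v w. v \<in> V \<and> w \<in> W}"
    using assms by (simp add: is_direct_sum_def)
  then show thesis
    using that by blast
qed

lemma orthonormal_expansion: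
  assumes "finite E" "orthonormal E" "x \<in> cspan E"
  shows "x = (\<Sum>e\<in>E. cinner x e *\<^sub>C e)"
proof -
  let ?r = "x - (\<Sum>e\<in>E. cinner x e *\<^sub>C e)"
  have "?r \<in> cspan E"
    using assms(3)
    by (intro complex_vector.span_diff complex_vector.span_sum complex_vector.span_scale)
      (auto intro: complex_vector.span_base)
  with diff_expansion_in_orth_compl[OF assms(1,2), of x] have "cinner ?r ?r = 0"
    unfolding orth_compl_def by blast
  then show ?thesis
    unfolding cinner_self_eq_0 right_minus_eq .
qed

context finite_dim_hilbert
begin

lemma is_direct_sum_orth_compl:
  fixes M :: "'a set"
  assumes "csubspace M"
  shows "is_direct_sum M (orth_compl M)"
proof -
  obtain E where E: "finite E" "orthonormal E" "cspan E = M"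
    using ex_orthonormal_basis[OF assms] .
  have "x \<in> {v + w | v w. v \<in> M \<and> w \<in> orth_compl M}" for x
  proof -
    let ?p = "\<Sum>e\<in>E. cinner x e *\<^sub>C e"
    have "x = ?p + (x - ?p)"
      by simp
    moreover have "?p \<in> M"
      unfolding E(3)[symmetric]
      by (intro complex_vector.span_sum complex_vector.span_scale complex_vector.span_base)
    moreover have "x - ?p \<in> orth_compl M"
      using diff_expansion_in_orth_compl[OF E(1,2), of x] E(3) by simp
    ultimately show ?thesis
      by blast
  qed
  then have "{v + w | v w. v \<in> M \<and> w \<in> orth_compl M} = UNIV"
    by blast
  moreover have "M \<inter> orth_compl M = {0}"
  proof
    show "M \<inter> orth_compl M \<subseteq> {0}"
    proof
      fix x assume "x \<in> M \<inter> orth_compl M"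
      then have "cinner x x = 0"
        unfolding orth_compl_def by blast
      then show "x \<in> {0}"
        by simp
    qed
    show "{0} \<subseteq> M \<inter> orth_compl M"
      using assms csubspace_orth_compl[of M] by (simp add: complex_vector.subspace_0)
  qed
  ultimately show ?thesis
    using assms csubspace_orth_compl[of M] unfolding is_direct_sum_def by (intro conjI)
qed

lemma orth_compl_orth_compl:
  fixes M :: "'a set"
  assumes "csubspace M"
  shows "orth_compl (orth_compl M) = M"
proof
  show "M \<subseteq> orth_compl (orth_compl M)"
  proof
    fix x assume "x \<in> M"
    have "cinner x y = 0" if "y \<in> orth_compl M" for y
    proof -
      have "cinner y x = 0"
        using that \<open>x \<in> M\<close> unfolding orth_compl_def by blast
      then show ?thesis
        by (rule cinner_eq_0_commute[THEN iffD1])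
    qed
    then show "x \<in> orth_compl (orth_compl M)"
      unfolding orth_compl_def[of "orth_compl M"] by blast
  qed
next
  show "orth_compl (orth_compl M) \<subseteq> M"
  proof
    fix x assume x: "x \<in> orth_compl (orth_compl M)"
    obtain v w where vw: "x = v + w" "v \<in> M" "w \<in> orth_compl M"
      using is_direct_sumE[OF is_direct_sum_orth_compl[OF assms]] .
    have "cinner x w = 0"
      using x vw(3) unfolding orth_compl_def[of "orth_compl M"] by blast
    moreover have "cinner w v = 0"
      using vw(2,3) unfolding orth_compl_def by blast
    then have "cinner v w = 0"
      by (rule cinner_eq_0_commute[THEN iffD1])
    ultimately have "w = 0"
      using vw(1) by (simp add: cinner_add_left)
    with vw show "x \<in> M"
      by simp
  qed
qed

end

lemma orth_compl_UNIV: "orth_compl (UNIV :: 'a::complex_hilbert set) = {0}"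
proof -
  have "x = 0" if "x \<in> orth_compl UNIV" for x :: 'a
    using that cinner_self_eq_0[of x] by (simp only: orth_compl_def mem_Collect_eq) blast
  then show ?thesis
    by (auto simp: orth_compl_def)
qed

lemma orth_compl_zero: "orth_compl {0 :: 'a::complex_hilbert} = UNIV"
  by (auto simp: orth_compl_def)

lemma cinner_right_eqI:
  assumes "\<And>z. cinner z x = cinner z (y :: 'a::complex_hilbert)"
  shows "x = y"
  using assms[of "x - y"] cinner_diff_right[of "x - y" x y] by simp

lemma clinear_add: "clinear T \<Longrightarrow> T (x + y) = T x + T y"
  and clinear_scale: "clinear T \<Longrightarrow> T (c *\<^sub>C x) = c *\<^sub>C T x"
  by (simp_all add: linear_iff_module_hom module_hom_iff)

lemma clinear_0: "clinear T \<Longrightarrow> T 0 = 0"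
  using clinear_add[of T 0 0] by simp

lemma clinear_diff: "clinear T \<Longrightarrow> T (x - y) = T x - T y"
  using clinear_add[of T "x - y" y] by simp

lemma clinear_sum: "clinear T \<Longrightarrow> T (sum g S) = (\<Sum>i\<in>S. T (g i))"
  by (induction S rule: infinite_finite_induct) (simp_all add: clinear_0 clinear_add)

lemma clinearI:
  assumes "\<And>x y. T (x + y) = T x + T y" "\<And>c x. T (c *\<^sub>C x) = c *\<^sub>C T x"
  shows "clinear T"
  using assms
  by (simp add: linear_iff_module_hom module_hom_iff complex_vector.module_axioms)

lemma csubspace_range: "clinear T \<Longrightarrow> csubspace (range T)"
proof (rule complex_vector.subspaceI)
  assume T: "clinear T"
  show "0 \<in> range T"
    using clinear_0[OF T] by (intro range_eqI[of _ _ 0]) simp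
  show "x + y \<in> range T" if "x \<in> range T" "y \<in> range T" for x y
    using that by (auto simp: clinear_add[OF T, symmetric])
  show "c *\<^sub>C x \<in> range T" if "x \<in> range T" for c x
    using that by (auto simp: clinear_scale[OF T, symmetric])
qed

lemma csubspace_vimage:
  assumes "clinear T" "csubspace M"
  shows "csubspace {x. T x \<in> M}"
  using assms(2)
  by (auto intro!: complex_vector.subspaceI simp: clinear_0[OF assms(1)] clinear_add[OF assms(1)]
      clinear_scale[OF assms(1)] complex_vector.subspace_0 complex_vector.subspace_add
      complex_vector.subspace_scale)

lemma clinear_minus_scalar:
  assumes "clinear T"
  shows "clinear (minus_scalar T l)"
  by (rule clinearI)
    (simp_all add: minus_scalar_def clinear_add[OF assms] clinear_scale[OF assms]
      scaleC_add_right complex_vector.scale_right_diff_distrib scaleC_scaleC mult.commute)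

context finite_dim_hilbert
begin

text \<open>\<open>cadjoint\<close> is a definite description, so that the adjoint has to be exhibited before anything
  can be said about it: expanding \<open>x\<close> in an orthonormal basis shows that
  \<open>y \<mapsto> (\<Sum>e\<in>E. cinner y (A e) *\<^sub>C e)\<close> is one, and it is the only one because the inner product is
  nondegenerate.\<close>

lemma cinner_cadjoint:
  fixes A :: "'a \<Rightarrow> 'a"
  assumes "clinear A"
  shows "cinner (A x) y = cinner x (cadjoint A y)"
proof -
  obtain E :: "'a set" where E: "finite E" "orthonormal E" "cspan E = UNIV"
    using ex_orthonormal_basis[OF complex_vector.subspace_UNIV] .
  define C where "C y = (\<Sum>e\<in>E. cinner y (A e) *\<^sub>C e)" for y
  have C: "cinner (A x) y = cinner x (C y)" for x y
  proof -
    have "A x = (\<Sum>e\<in>E. cinner x e *\<^sub>C A e)"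
      by (subst orthonormal_expansion[OF E(1,2), of x])
        (simp_all add: E(3) clinear_sum[OF assms] clinear_scale[OF assms])
    then have "cinner (A x) y = (\<Sum>e\<in>E. cinner x e * cinner (A e) y)"
      by (simp add: cinner_sum_left cinner_scaleC_left)
    also have "\<dots> = cinner x (C y)"
      unfolding C_def cinner_sum_right cinner_scaleC_right
      by (rule sum.cong) (simp_all add: cinner_commute[symmetric] mult.commute)
    finally show ?thesis .
  qed
  have "cadjoint A = C"
    unfolding cadjoint_def
  proof (rule the_equality)
    show "\<forall>x y. cinner (A x) y = cinner x (C y)"
      using C by blast
    fix D assume "\<forall>x y. cinner (A x) y = cinner x (D y)"
    then show "D = C"
      by (intro ext cinner_right_eqI) (simp add: C[symmetric])
  qed
  with C show ?thesis
    by simp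
qed

lemma clinear_cadjoint:
  fixes A :: "'a \<Rightarrow> 'a"
  assumes "clinear A"
  shows "clinear (cadjoint A)"
  by (rule clinearI; rule cinner_right_eqI)
    (simp_all add: cinner_cadjoint[OF assms, symmetric] cinner_add_right cinner_scaleC_right)

lemma ker_cadjoint:
  fixes A :: "'a \<Rightarrow> 'a"
  assumes "clinear A"
  shows "ker (minus_scalar (cadjoint A) (cnj l)) = orth_compl (range (minus_scalar A l))"
proof -
  have *: "cinner (minus_scalar A l z) x = cinner z (minus_scalar (cadjoint A) (cnj l) x)" for x z
    by (simp add: minus_scalar_def cinner_diff_left cinner_diff_right cinner_scaleC_left
        cinner_scaleC_right cinner_cadjoint[OF assms])
  have "x \<in> orth_compl (range (minus_scalar A l)) \<longleftrightarrow>
      (\<forall>z. cinner (minus_scalar A l z) x = 0)" for x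
    by (simp add: orth_compl_def cinner_eq_0_commute[of x])
  moreover have "(\<forall>z. cinner z u = 0) \<longleftrightarrow> u = 0" for u :: 'a
    using cinner_self_eq_0[of u] cinner_zero_right by blast
  ultimately show ?thesis
    by (auto simp: ker_def *)
qed

lemma orth_compl_ker_cadjoint:
  fixes A :: "'a \<Rightarrow> 'a"
  assumes "clinear A"
  shows "orth_compl (ker (minus_scalar (cadjoint A) (cnj l))) = range (minus_scalar A l)"
  unfolding ker_cadjoint[OF assms]
  by (intro orth_compl_orth_compl csubspace_range clinear_minus_scalar assms)

text \<open>In finite dimension \<open>A - l\<close> is injective exactly if it is surjective. The description by the
  range is the one that passes to the adjoint by taking orthogonal complements.\<close>

lemma in_cspectrum_iff_range:
  fixes A :: "'a \<Rightarrow> 'a"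
  assumes "clinear A"
  shows "l \<in> cspectrum A \<longleftrightarrow> range (minus_scalar A l) \<noteq> UNIV"
proof -
  let ?T = "minus_scalar A l"
  have T: "clinear ?T"
    using assms by (rule clinear_minus_scalar)
  have "l \<in> cspectrum A \<longleftrightarrow> (\<exists>x. x \<noteq> 0 \<and> ?T x = 0)"
    by (simp add: cspectrum_def minus_scalar_def)
  also have "\<dots> \<longleftrightarrow> \<not> inj ?T"
  proof
    assume "\<exists>x. x \<noteq> 0 \<and> ?T x = 0"
    then show "\<not> inj ?T"
      using clinear_0[OF T] injD[of ?T _ 0] by fastforce
  next
    assume "\<not> inj ?T"
    then obtain x y where "?T x = ?T y" "x \<noteq> y"
      by (auto simp: inj_def)
    then show "\<exists>x. x \<noteq> 0 \<and> ?T x = 0"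
      by (intro exI[of _ "x - y"]) (simp add: clinear_diff[OF T])
  qed
  also have "\<dots> \<longleftrightarrow> \<not> surj ?T"
    using linear_inj_imp_surj[OF T] linear_surj_imp_inj[OF T] by blast
  finally show ?thesis .
qed

text \<open>Both sides say that \<open>ran (A - l)\<close> is proper: the orthogonal complement of this range is the
  kernel of \<open>A* - cnj l\<close>.\<close>

lemma cnj_in_cspectrum_cadjoint:
  fixes A :: "'a \<Rightarrow> 'a"
  assumes "clinear A"
  shows "cnj l \<in> cspectrum (cadjoint A) \<longleftrightarrow> l \<in> cspectrum A"
proof -
  let ?K = "ker (minus_scalar (cadjoint A) (cnj l))"
  have "0 \<in> ?K"
    unfolding ker_cadjoint[OF assms] using csubspace_orth_compl complex_vector.subspace_0 by blast
  then have "cnj l \<in> cspectrum (cadjoint A) \<longleftrightarrow> ?K \<noteq> {0}"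
    by (auto simp: cspectrum_def ker_def minus_scalar_def)
  also have "\<dots> \<longleftrightarrow> range (minus_scalar A l) \<noteq> UNIV"
  proof -
    have "?K = {0}" if "range (minus_scalar A l) = UNIV"
      using ker_cadjoint[OF assms, of l] orth_compl_UNIV by (simp add: that)
    moreover have "range (minus_scalar A l) = UNIV" if "?K = {0}"
      using orth_compl_ker_cadjoint[OF assms, of l, unfolded that] orth_compl_zero by auto
    ultimately show ?thesis
      by blast
  qed
  finally show ?thesis
    using in_cspectrum_iff_range[OF assms] by simp
qed

end

section \<open>Projections along a complement\<close>

text \<open>The projection changes a vector only by an element of \<open>W\<close>. So reaching all of \<open>V\<close> from \<open>F\<close> is the
  same as reaching everything modulo \<open>W\<close>, whichever complement \<open>V\<close> of \<open>W\<close> was chosen.\<close>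

lemma proj_along_image_eq_iff:
  assumes "is_direct_sum V W"
  shows "proj_along V W ` F = V \<longleftrightarrow> {v + w | v w. v \<in> F \<and> w \<in> W} = UNIV"
proof -
  have V: "csubspace V" and W: "csubspace W" and disj: "V \<inter> W = {0}"
    using assms by (simp_all add: is_direct_sum_def)
  have proj_eq: "proj_along V W x = v" if "v \<in> V" "x - v \<in> W" for x v
    unfolding proj_along_def
  proof (rule the_equality)
    show "v \<in> V \<and> x - v \<in> W"
      using that ..
    fix u assume u: "u \<in> V \<and> x - u \<in> W"
    have "u - v \<in> V"
      using u that V complex_vector.subspace_diff by blast
    moreover have "u - v \<in> W"
      using complex_vector.subspace_diff[OF W, of "x - v" "x - u"] u that by simp
    ultimately have "u - v \<in> {0}"
      unfolding disj[symmetric] by (rule IntI)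
    then show "u = v"
      by simp
  qed
  have proj: "proj_along V W x \<in> V" "x - proj_along V W x \<in> W" for x
  proof -
    obtain v w where "x = v + w" "v \<in> V" "w \<in> W"
      using is_direct_sumE[OF assms] .
    then show "proj_along V W x \<in> V" "x - proj_along V W x \<in> W"
      using proj_eq[of v x] by simp_all
  qed
  show ?thesis
  proof
    assume *: "proj_along V W ` F = V"
    have "\<exists>u\<in>F. \<exists>r\<in>W. x = u + r" for x
    proof -
      obtain v w where x: "x = v + w" "v \<in> V" "w \<in> W"
        using is_direct_sumE[OF assms] .
      obtain u where u: "u \<in> F" "v = proj_along V W u"
        using * x(2) by blast
      have "w - (u - v) \<in> W"
        using complex_vector.subspace_diff[OF W x(3)] proj(2)[of u] u(2) by simp
      moreover have "x = u + (w - (u - v))"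
        using x(1) by simp
      ultimately show ?thesis
        using u(1) by blast
    qed
    then show "{v + w | v w. v \<in> F \<and> w \<in> W} = UNIV"
      by blast
  next
    assume *: "{v + w | v w. v \<in> F \<and> w \<in> W} = UNIV"
    have "v \<in> proj_along V W ` F" if "v \<in> V" for v
    proof -
      obtain u w where u: "v = u + w" "u \<in> F" "w \<in> W"
        using * by blast
      have "u - v \<in> W"
        using complex_vector.subspace_neg[OF W u(3)] u(1) by simp
      then show ?thesis
        using proj_eq[OF that] u(2) by blast
    qed
    then show "proj_along V W ` F = V"
      using proj(1) by blast
  qed
qed

section \<open>Krylov subspaces\<close>

definition krylov :: "('a::complex_hilbert \<Rightarrow> 'a) \<Rightarrow> 'a set \<Rightarrow> nat \<Rightarrow> 'a set" where
  "krylov T S k = cspan {(T ^^ n) s | n s. n < k \<and> s \<in> S}"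

lemma krylov_mono: "j \<le> k \<Longrightarrow> krylov T S j \<subseteq> krylov T S k"
  unfolding krylov_def by (rule complex_vector.span_mono) (use order_less_le_trans in blast)

lemma funpow_in_krylov: "n < k \<Longrightarrow> s \<in> S \<Longrightarrow> (T ^^ n) s \<in> krylov T S k"
  unfolding krylov_def by (rule complex_vector.span_base) blast

lemma csubspace_krylov: "csubspace (krylov T S k)"
  unfolding krylov_def by (rule complex_vector.subspace_span)

lemma krylov_minimal:
  assumes "csubspace M" "\<And>n s. n < k \<Longrightarrow> s \<in> S \<Longrightarrow> (T ^^ n) s \<in> M"
  shows "krylov T S k \<subseteq> M"
  unfolding krylov_def
  by (rule complex_vector.span_minimal[OF _ assms(1)]) (use assms(2) in blast)

lemma image_krylov_subset:
  assumes "clinear T"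
  shows "T ` krylov T S k \<subseteq> krylov T S (Suc k)"
proof -
  have "krylov T S k \<subseteq> {x. T x \<in> krylov T S (Suc k)}"
  proof (rule krylov_minimal)
    show "csubspace {x. T x \<in> krylov T S (Suc k)}"
      by (rule csubspace_vimage[OF assms csubspace_krylov])
    show "(T ^^ n) s \<in> {x. T x \<in> krylov T S (Suc k)}" if "n < k" "s \<in> S" for n s
      using funpow_in_krylov[of "Suc n" "Suc k" s S T] that by simp
  qed
  then show ?thesis
    by blast
qed

text \<open>Once two consecutive Krylov subspaces agree, the subspace is mapped into itself, and the chain
  stays constant from there on.\<close>

lemma funpow_in_krylov_if_stationary:
  assumes "clinear T" "krylov T S (Suc k) = krylov T S k" "s \<in> S"
  shows "(T ^^ n) s \<in> krylov T S k"
proof (induction n)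
  case 0
  show ?case
    using funpow_in_krylov[of 0 "Suc k" s S T] assms(2,3) by simp
next
  case (Suc n)
  then show ?case
    using image_krylov_subset[OF assms(1), of S k] assms(2) by auto
qed

context finite_dim_hilbert
begin

text \<open>Each strict inclusion in the chain of Krylov subspaces raises the dimension, which is at most
  \<open>card B\<close>. So the chain is stationary after at most \<open>card B\<close> steps. This yields the exponent bound
  of the Cayley-Hamilton theorem for all vectors of \<open>S\<close> at once.\<close>

lemma funpow_in_krylov_card_basis:
  fixes T :: "'a \<Rightarrow> 'a"
  assumes "clinear T" "s \<in> S"
  shows "(T ^^ n) s \<in> krylov T S (card B)"
proof -
  have "\<exists>k\<le>card B. krylov T S (Suc k) = krylov T S k"
  proof (rule ccontr)
    let ?G = "\<lambda>k. {(T ^^ n) s | n s. n < k \<and> s \<in> S}"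
    assume "\<not> ?thesis"
    then have less: "krylov T S k \<subset> krylov T S (Suc k)" if "k \<le> card B" for k
      using that krylov_mono[of k "Suc k" T S] by (metis le_SucI order_refl psubsetI)
    have "k \<le> dim (?G k)" if "k \<le> Suc (card B)" for k
      using that
    proof (induction k)
      case (Suc k)
      then have "dim (?G k) < dim (?G (Suc k))"
        using less[of k] unfolding krylov_def by (intro dim_psubset) simp
      with Suc show ?case
        by simp
    qed simp
    from this[of "Suc (card B)"] have "Suc (card B) \<le> dim (?G (Suc (card B)))"
      by simp
    with dim_subset_UNIV[of "?G (Suc (card B))"] show False
      by (simp add: dimension_def)
  qed
  then obtain k where k: "k \<le> card B" "krylov T S (Suc k) = krylov T S k"
    by blast
  show ?thesis
    using funpow_in_krylov_if_stationary[OF assms(1) k(2) assms(2)] krylov_mono[OF k(1)] by blast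
qed

lemma krylov_card_basis_invariant:
  fixes T :: "'a \<Rightarrow> 'a"
  assumes "clinear T" "x \<in> krylov T S (card B)"
  shows "T x \<in> krylov T S (card B)"
proof -
  have "krylov T S (card B) \<subseteq> {x. T x \<in> krylov T S (card B)}"
  proof (rule krylov_minimal)
    show "csubspace {x. T x \<in> krylov T S (card B)}"
      by (rule csubspace_vimage[OF assms(1) csubspace_krylov])
    show "(T ^^ n) s \<in> {x. T x \<in> krylov T S (card B)}" if "s \<in> S" for n s
      using funpow_in_krylov_card_basis[OF assms(1) that, of "Suc n"] by simp
  qed
  with assms(2) show ?thesis
    by blast
qed

end

section \<open>Eigenvectors in invariant subspaces\<close>

text \<open>Horner evaluation of \<open>p(T) x\<close>.\<close>

definition poly_apply :: "('a::complex_hilbert \<Rightarrow> 'a) \<Rightarrow> complex poly \<Rightarrow> 'a \<Rightarrow> 'a" where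
  "poly_apply T p x = fold_coeffs (\<lambda>a y. a *\<^sub>C x + T y) p 0"

lemma poly_apply_0: "poly_apply T 0 x = 0"
  by (simp add: poly_apply_def)

lemma poly_apply_pCons:
  assumes "clinear T"
  shows "poly_apply T (pCons a p) x = a *\<^sub>C x + T (poly_apply T p x)"
  by (cases "p = 0 \<and> a = 0")
    (auto simp: poly_apply_def clinear_0[OF assms])

lemma poly_apply_add:
  assumes "clinear T"
  shows "poly_apply T (p + q) x = poly_apply T p x + poly_apply T q x"
  by (induction p q rule: poly_induct2)
    (simp_all add: poly_apply_0 poly_apply_pCons[OF assms] clinear_add[OF assms]
      complex_vector.scale_left_distrib algebra_simps)

lemma poly_apply_smult:
  assumes "clinear T"
  shows "poly_apply T (smult c p) x = c *\<^sub>C poly_apply T p x"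
  by (induction p)
    (simp_all add: poly_apply_0 poly_apply_pCons[OF assms] clinear_scale[OF assms]
      complex_vector.scale_right_distrib)

lemma poly_apply_monom:
  assumes "clinear T"
  shows "poly_apply T (monom 1 n) x = (T ^^ n) x"
  by (induction n)
    (simp_all add: monom_0 monom_Suc poly_apply_0 poly_apply_pCons[OF assms] clinear_0[OF assms])

lemma poly_apply_in_invariant:
  assumes "clinear T" "csubspace M" "\<And>y. y \<in> M \<Longrightarrow> T y \<in> M" "x \<in> M"
  shows "poly_apply T p x \<in> M"
  by (induction p)
    (simp_all add: poly_apply_0 poly_apply_pCons[OF assms(1)] complex_vector.subspace_0[OF assms(2)]
      complex_vector.subspace_add[OF assms(2)] complex_vector.subspace_scale[OF assms(2)] assms(3,4))

context finite_dim_hilbert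
begin

text \<open>The vectors \<open>p(T) x\<close> with \<open>deg p < card B\<close> form the Krylov subspace of \<open>x\<close>, which contains
  \<open>T^(card B) x\<close>.\<close>

lemma ex_annihilating_poly:
  fixes T :: "'a \<Rightarrow> 'a"
  assumes "clinear T"
  obtains p where "p \<noteq> 0" "poly_apply T p x = 0"
proof -
  let ?M = "{poly_apply T q x | q. \<forall>n\<ge>card B. coeff q n = 0}"
  have "krylov T {x} (card B) \<subseteq> ?M"
  proof (rule krylov_minimal)
    show "csubspace ?M"
    proof (rule complex_vector.subspaceI)
      show "0 \<in> ?M"
        by (rule CollectI, rule exI[of _ 0]) (simp add: poly_apply_0)
    next
      fix y z assume "y \<in> ?M" "z \<in> ?M"
      then obtain p q where "y = poly_apply T p x" "z = poly_apply T q x"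
          "\<forall>n\<ge>card B. coeff p n = 0" "\<forall>n\<ge>card B. coeff q n = 0"
        by blast
      then show "y + z \<in> ?M"
        by (intro CollectI exI[of _ "p + q"]) (simp add: poly_apply_add[OF assms])
    next
      fix c y assume "y \<in> ?M"
      then obtain p where "y = poly_apply T p x" "\<forall>n\<ge>card B. coeff p n = 0"
        by blast
      then show "c *\<^sub>C y \<in> ?M"
        by (intro CollectI exI[of _ "smult c p"]) (simp add: poly_apply_smult[OF assms])
    qed
    show "(T ^^ n) s \<in> ?M" if "n < card B" "s \<in> {x}" for n s
      using that
      by (intro CollectI exI[of _ "monom 1 n"]) (simp add: poly_apply_monom[OF assms])
  qed
  then obtain q where q: "(T ^^ card B) x = poly_apply T q x" "coeff q (card B) = 0"
    using funpow_in_krylov_card_basis[OF assms, of x "{x}" "card B"] by blast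
  let ?p = "monom 1 (card B) + smult (-1) q"
  have "poly_apply T ?p x = 0"
    unfolding poly_apply_add[OF assms] poly_apply_smult[OF assms] poly_apply_monom[OF assms]
    by (simp add: q(1))
  moreover have "coeff ?p (card B) = 1"
    using q(2) by simp
  then have "?p \<noteq> 0"
    by (metis coeff_0 zero_neq_one)
  ultimately show thesis
    using that by blast
qed

text \<open>Let \<open>p\<close> be a polynomial of least degree with \<open>p(T) x = 0\<close>, and split off a root \<open>z\<close>, say
  \<open>p = (X - z) q\<close>. Then \<open>q(T) x\<close> is nonzero by minimality and is killed by \<open>T - z\<close>.\<close>

lemma ex_eigenvector_in_invariant:
  fixes T :: "'a \<Rightarrow> 'a"
  assumes T: "clinear T" and M: "csubspace M" and inv: "\<And>y. y \<in> M \<Longrightarrow> T y \<in> M"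
    and x: "x \<in> M" "x \<noteq> 0"
  obtains y l where "y \<in> M" "y \<noteq> 0" "T y = l *\<^sub>C y"
proof -
  let ?P = "\<lambda>p. p \<noteq> 0 \<and> poly_apply T p x = 0"
  obtain p0 where "?P p0"
    using ex_annihilating_poly[OF T] by blast
  then obtain p where p: "?P p" and min: "\<And>q. ?P q \<Longrightarrow> degree p \<le> degree q"
    using ex_has_least_nat[of ?P p0 degree] by blast
  have "degree p \<noteq> 0"
  proof
    assume "degree p = 0"
    then obtain c where c: "p = [:c:]"
      by (rule degree_eq_zeroE)
    with p have "c *\<^sub>C x = 0"
      by (auto simp: poly_apply_pCons[OF T] poly_apply_0 clinear_0[OF T])
    with p c x(2) show False
      by auto
  qed
  then have "\<not> constant (poly p)"
    by (simp add: constant_degree)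
  then obtain z where "poly p z = 0"
    using fundamental_theorem_of_algebra by blast
  then obtain q where q: "p = [:- z, 1:] * q"
    by (auto simp: poly_eq_0_iff_dvd elim: dvdE)
  let ?y = "poly_apply T q x"
  have "q \<noteq> 0"
    using p q by auto
  then have "degree q < degree p"
    unfolding q by (subst degree_mult_eq) auto
  then have "?y \<noteq> 0"
    using min[of q] \<open>q \<noteq> 0\<close> by auto
  moreover have "?y \<in> M"
    by (rule poly_apply_in_invariant[OF T M inv x(1)])
  moreover have "T ?y = z *\<^sub>C ?y"
  proof -
    have "p = smult (- z) q + pCons 0 q"
      unfolding q by simp
    then have "poly_apply T p x = (- z) *\<^sub>C ?y + T ?y"
      by (simp only: poly_apply_add[OF T] poly_apply_smult[OF T] poly_apply_pCons[OF T]) simp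
    with p show ?thesis
      by simp
  qed
  ultimately show thesis
    using that by blast
qed

section \<open>Krylov subspaces that exhaust the space\<close>

text \<open>Each \<open>cspan S + ran (A - l)\<close> is \<open>A\<close>-invariant, so
  that the Krylov subspace lies in it. If the Krylov
  subspace is proper, an eigenvector of the adjoint orthogonal
  to the Krylov subspace is orthogonal to one of these sums. In control theory this is the Hautus
  criterion for the controllability of \<open>(A, S)\<close>.\<close>

lemma krylov_eq_UNIV_iff:
  fixes A :: "'a \<Rightarrow> 'a"
  assumes A: "clinear A"
  shows "krylov A S (card B) = UNIV \<longleftrightarrow>
    (\<forall>l\<in>cspectrum A. {v + w | v w. v \<in> cspan S \<and> w \<in> range (minus_scalar A l)} = UNIV)"
    (is "?K = UNIV \<longleftrightarrow> (\<forall>l\<in>_. ?G l = UNIV)")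
proof
  assume K: "?K = UNIV"
  show "\<forall>l\<in>cspectrum A. ?G l = UNIV"
  proof
    fix l
    have R: "csubspace (range (minus_scalar A l))"
      by (intro csubspace_range clinear_minus_scalar A)
    have G: "csubspace (?G l)"
      by (intro complex_vector.subspace_sums complex_vector.subspace_span R)
    have R_sub: "range (minus_scalar A l) \<subseteq> ?G l"
      using complex_vector.span_zero[of S] by force
    have S_sub: "S \<subseteq> ?G l"
      using complex_vector.span_base[of _ S] complex_vector.subspace_0[OF R] by force
    \<comment> \<open>\<open>A\<close> acts on the quotient by \<open>ran (A - l)\<close> as the scalar \<open>l\<close>.\<close>
    have A_inv: "A g \<in> ?G l" if "g \<in> ?G l" for g
    proof -
      have "A g = l *\<^sub>C g + minus_scalar A l g"
        by (simp add: minus_scalar_def)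
      then show ?thesis
        using that G R_sub by (metis (no_types, lifting) complex_vector.subspace_add
            complex_vector.subspace_scale rangeI subsetD)
    qed
    have "(A ^^ n) s \<in> ?G l" if "s \<in> S" for n s
      by (induction n) (use S_sub that A_inv in auto)
    then have "?K \<subseteq> ?G l"
      by (intro krylov_minimal G)
    with K show "?G l = UNIV"
      by blast
  qed
next
  assume G: "\<forall>l\<in>cspectrum A. ?G l = UNIV"
  show "?K = UNIV"
  proof (rule ccontr)
    assume "?K \<noteq> UNIV"
    moreover have "orth_compl (orth_compl ?K) = ?K"
      by (rule orth_compl_orth_compl[OF csubspace_krylov])
    ultimately have "orth_compl ?K \<noteq> {0}"
      using orth_compl_zero by metis
    moreover have "0 \<in> orth_compl ?K"
      by (rule complex_vector.subspace_0[OF csubspace_orth_compl])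
    ultimately obtain x0 where x0: "x0 \<in> orth_compl ?K" "x0 \<noteq> 0"
      by blast
    have inv: "cadjoint A y \<in> orth_compl ?K" if y: "y \<in> orth_compl ?K" for y
    proof -
      have "cinner (cadjoint A y) k = 0" if "k \<in> ?K" for k
      proof -
        have "cinner y (A k) = 0"
          using y krylov_card_basis_invariant[OF A that] by (simp add: orth_compl_def)
        then have "cinner k (cadjoint A y) = 0"
          unfolding cinner_cadjoint[OF A, symmetric] by (rule cinner_eq_0_commute[THEN iffD1])
        then show ?thesis
          by (rule cinner_eq_0_commute[THEN iffD1])
      qed
      then show ?thesis
        by (simp add: orth_compl_def)
    qed
    obtain x l where x: "x \<in> orth_compl ?K" "x \<noteq> 0" "cadjoint A x = cnj (cnj l) *\<^sub>C x"
      using ex_eigenvector_in_invariant[OF clinear_cadjoint[OF A] csubspace_orth_compl inv x0]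
      by (metis complex_cnj_cnj)
    then have "cnj (cnj l) \<in> cspectrum (cadjoint A)"
      by (auto simp: cspectrum_def)
    then have "cnj l \<in> cspectrum A"
      unfolding cnj_in_cspectrum_cadjoint[OF A] .
    then have "x \<in> ?G (cnj l)"
      using G by blast
    then obtain v w where vw: "x = v + w" "v \<in> cspan S" "w \<in> range (minus_scalar A (cnj l))"
      by blast
    \<comment> \<open>The vectors of \<open>S\<close> are generators of \<open>?K\<close> only if \<open>card B\<close> is positive; in general this uses stationarity.\<close>
    have "S \<subseteq> ?K"
      using funpow_in_krylov_card_basis[OF A, of _ S 0] by auto
    then have "cspan S \<subseteq> ?K"
      by (rule complex_vector.span_minimal[OF _ csubspace_krylov])
    with x(1) vw(2) have "cinner x v = 0"
      by (auto simp: orth_compl_def)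
    moreover have "x \<in> ker (minus_scalar (cadjoint A) (cnj (cnj l)))"
      using x(3) by (simp add: ker_def minus_scalar_def)
    then have "cinner x w = 0"
      using vw(3) unfolding ker_cadjoint[OF A] orth_compl_def by blast
    ultimately have "cinner x x = 0"
      using vw(1) cinner_add_right[of x v w] by simp
    with x(2) show False
      by simp
  qed
qed

end

section \<open>Frames and complete systems in finite dimension\<close>

context finite_dim_hilbert
begin

lemma csubspace_eq_UNIV_iff_orth_compl:
  fixes M :: "'a set"
  assumes "csubspace M"
  shows "M = UNIV \<longleftrightarrow> (\<forall>x\<in>orth_compl M. x = 0)"
proof
  show "M = UNIV \<Longrightarrow> \<forall>x\<in>orth_compl M. x = 0"
    using orth_compl_UNIV by auto
next
  assume "\<forall>x\<in>orth_compl M. x = 0"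
  then have "orth_compl M = {0}"
    using complex_vector.subspace_0[OF csubspace_orth_compl[of M]] by blast
  then show "M = UNIV"
    using orth_compl_orth_compl[OF assms] orth_compl_zero by auto
qed

text \<open>A vector \<open>x\<close> orthogonal to a subspace has distance at least \<open>norm x\<close> to each of its elements.
  Hence a dense subspace has trivial orthogonal complement.\<close>

lemma is_complete_system_iff_span:
  fixes \<phi> :: "'i \<Rightarrow> 'a"
  shows "is_complete_system \<phi> I \<longleftrightarrow> cspan (\<phi> ` I) = UNIV"
proof
  assume "is_complete_system \<phi> I"
  then have dense: "closure (cspan (\<phi> ` I)) = UNIV"
    by (simp add: is_complete_system_def)
  have "x = 0" if x: "x \<in> orth_compl (cspan (\<phi> ` I))" for x
  proof (rule ccontr)
    assume "x \<noteq> 0"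
    then have "0 < norm x"
      by simp
    then obtain y where y: "y \<in> cspan (\<phi> ` I)" "dist y x < norm x"
      using dense closure_approachable[of x "cspan (\<phi> ` I)"] by blast
    \<comment> \<open>The inequality comes from Pythagoras for \<open>x - y\<close>.\<close>
    have "cinner x (- y) = 0"
      using x complex_vector.span_neg[OF y(1)] by (simp add: orth_compl_def)
    from norm_add_orthogonal[OF this] have "(norm x)\<^sup>2 \<le> (dist y x)\<^sup>2"
      by (simp add: dist_norm norm_minus_commute)
    then have "norm x \<le> dist y x"
      by (rule power2_le_imp_le) simp
    with y(2) show False
      by simp
  qed
  then show "cspan (\<phi> ` I) = UNIV"
    by (simp add: csubspace_eq_UNIV_iff_orth_compl)
qed (simp add: is_complete_system_def)

lemma parseval:
  fixes E :: "'a set"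
  assumes "finite E" "orthonormal E" "x \<in> cspan E"
  shows "(norm x)\<^sup>2 = (\<Sum>e\<in>E. (cmod (cinner x e))\<^sup>2)"
proof -
  have "cinner x x = cinner x (\<Sum>e\<in>E. cinner x e *\<^sub>C e)"
    using orthonormal_expansion[OF assms] by (rule arg_cong)
  also have "\<dots> = (\<Sum>e\<in>E. complex_of_real ((cmod (cinner x e))\<^sup>2))"
    unfolding cinner_sum_right cinner_scaleC_right complex_norm_square
    by (simp add: mult.commute)
  finally have "complex_of_real ((norm x)\<^sup>2) = complex_of_real (\<Sum>e\<in>E. (cmod (cinner x e))\<^sup>2)"
    unfolding cinner_self by simp
  then show ?thesis
    unfolding of_real_eq_iff .
qed

text \<open>This gives the lower frame bound: each coefficient with respect to an orthonormal basis is
  controlled by the frame coefficients. The estimate sums over the image \<open>\<phi> ` I\<close> first, because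
  \<open>\<phi>\<close> may repeat vectors, and repetitions only increase the right-hand side.\<close>

lemma cinner_sq_le_of_in_span:
  fixes \<phi> :: "'i \<Rightarrow> 'a"
  assumes "finite I" "e \<in> cspan (\<phi> ` I)"
  obtains K where "0 \<le> K" "\<And>x. (cmod (cinner x e))\<^sup>2 \<le> K * (\<Sum>i\<in>I. (cmod (cinner x (\<phi> i)))\<^sup>2)"
proof -
  obtain u where u: "e = (\<Sum>v\<in>\<phi> ` I. u v *\<^sub>C v)"
    using assms complex_vector.span_finite[of "\<phi> ` I"] by auto
  let ?K = "\<Sum>v\<in>\<phi> ` I. (cmod (u v))\<^sup>2"
  show thesis
  proof (rule that)
    show "0 \<le> ?K"
      by (rule sum_nonneg) simp
    fix x
    have "cmod (cinner x e) \<le> (\<Sum>v\<in>\<phi> ` I. cmod (u v) * cmod (cinner x v))"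
      unfolding u cinner_sum_right cinner_scaleC_right
      by (rule order_trans[OF norm_sum]) (simp add: norm_mult)
    then have "(cmod (cinner x e))\<^sup>2 \<le> (\<Sum>v\<in>\<phi> ` I. cmod (u v) * cmod (cinner x v))\<^sup>2"
      by (rule power_mono) simp
    also have "\<dots> \<le> ?K * (\<Sum>v\<in>\<phi> ` I. (cmod (cinner x v))\<^sup>2)"
      by (rule Cauchy_Schwarz_ineq_sum)
    also have "\<dots> \<le> ?K * (\<Sum>i\<in>I. (cmod (cinner x (\<phi> i)))\<^sup>2)"
    proof (rule mult_left_mono)
      show "(\<Sum>v\<in>\<phi> ` I. (cmod (cinner x v))\<^sup>2) \<le> (\<Sum>i\<in>I. (cmod (cinner x (\<phi> i)))\<^sup>2)"
        using sum_image_le[OF assms(1), of "\<lambda>v. (cmod (cinner x v))\<^sup>2" \<phi>] by (simp add: o_def)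
    qed (rule \<open>0 \<le> ?K\<close>)
    finally show "(cmod (cinner x e))\<^sup>2 \<le> ?K * (\<Sum>i\<in>I. (cmod (cinner x (\<phi> i)))\<^sup>2)" .
  qed
qed

lemma is_frame_iff_span:
  fixes \<phi> :: "'i \<Rightarrow> 'a"
  assumes "finite I"
  shows "is_frame \<phi> I \<longleftrightarrow> cspan (\<phi> ` I) = UNIV"
proof
  assume "is_frame \<phi> I"
  then obtain \<alpha> where \<alpha>: "0 < \<alpha>"
      "\<And>x. \<alpha> * (norm x)\<^sup>2 \<le> (\<Sum>\<^sub>\<infinity>i\<in>I. (cmod (cinner x (\<phi> i)))\<^sup>2)"
    unfolding is_frame_def by blast
  have "x = 0" if "x \<in> orth_compl (cspan (\<phi> ` I))" for x
  proof -
    have "cinner x (\<phi> i) = 0" if "i \<in> I" for i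
      using \<open>x \<in> _\<close> that unfolding orth_compl_cspan by (simp add: orth_compl_def)
    then have "(\<Sum>\<^sub>\<infinity>i\<in>I. (cmod (cinner x (\<phi> i)))\<^sup>2) = 0"
      using assms by (simp add: infsum_finite)
    with \<alpha>(2)[of x] have "\<alpha> * (norm x)\<^sup>2 \<le> 0"
      by simp
    with \<alpha>(1) show ?thesis
      by (simp add: mult_le_0_iff)
  qed
  then show "cspan (\<phi> ` I) = UNIV"
    by (simp add: csubspace_eq_UNIV_iff_orth_compl)
next
  assume span: "cspan (\<phi> ` I) = UNIV"
  let ?s = "\<lambda>x. \<Sum>i\<in>I. (cmod (cinner x (\<phi> i)))\<^sup>2"
  obtain E :: "'a set" where E: "finite E" "orthonormal E" "cspan E = UNIV"
    using ex_orthonormal_basis[OF complex_vector.subspace_UNIV] .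
  have "\<exists>K\<ge>0. \<forall>x. (cmod (cinner x e))\<^sup>2 \<le> K * ?s x" for e
    using cinner_sq_le_of_in_span[OF assms, of e] span by (metis UNIV_I)
  then obtain K where K: "\<And>e. 0 \<le> K e" "\<And>e x. (cmod (cinner x e))\<^sup>2 \<le> K e * ?s x"
    by metis
  \<comment> \<open>Adding 1 keeps the bounds positive also if the sums vanish, as in the zero space.\<close>
  define a where "a = 1 + (\<Sum>e\<in>E. K e)"
  define b where "b = 1 + (\<Sum>i\<in>I. (norm (\<phi> i))\<^sup>2)"
  have a: "0 < a" and b: "0 < b"
    unfolding a_def b_def using K(1)
    by (simp_all add: add_pos_nonneg sum_nonneg)
  have lower: "inverse a * (norm x)\<^sup>2 \<le> ?s x" for x
  proof -
    have "(norm x)\<^sup>2 = (\<Sum>e\<in>E. (cmod (cinner x e))\<^sup>2)"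
      by (rule parseval[OF E(1,2)]) (simp add: E(3))
    also have "\<dots> \<le> (\<Sum>e\<in>E. K e * ?s x)"
      by (rule sum_mono) (rule K(2))
    also have "\<dots> = (\<Sum>e\<in>E. K e) * ?s x"
      by (rule sum_distrib_right[symmetric])
    also have "\<dots> \<le> a * ?s x"
      by (rule mult_right_mono) (simp_all add: a_def sum_nonneg)
    finally show ?thesis
      using a by (simp add: field_simps)
  qed
  have upper: "?s x \<le> b * (norm x)\<^sup>2" for x
  proof -
    have "?s x \<le> (\<Sum>i\<in>I. (norm x * norm (\<phi> i))\<^sup>2)"
      by (intro sum_mono power_mono cmod_cinner_le) simp
    also have "\<dots> = (\<Sum>i\<in>I. (norm (\<phi> i))\<^sup>2) * (norm x)\<^sup>2"
      by (simp add: power_mult_distrib sum_distrib_left mult.commute)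
    also have "\<dots> \<le> b * (norm x)\<^sup>2"
      by (rule mult_right_mono) (simp_all add: b_def)
    finally show ?thesis .
  qed
  show "is_frame \<phi> I"
    unfolding is_frame_def infsum_finite[OF assms]
    by (rule exI[of _ "inverse a"], intro conjI exI[of _ b] allI)
      (use a b lower upper assms in \<open>simp_all add: summable_on_finite\<close>)
qed

end

section \<open>The equivalence\<close>

theorem theorem4p1:
  fixes A :: "'a::complex_hilbert \<Rightarrow> 'a"
    and d m :: nat
    and f :: "nat \<Rightarrow> 'a"
    and V :: "complex \<Rightarrow> 'a set"
    and F :: "'a set"
    and \<phi> :: "nat \<times> nat \<Rightarrow> 'a"
    and I :: "(nat \<times> nat) set"
  assumes dim: "\<exists>B :: 'a set. finite B \<and> card B = d \<and> \<not> cdependent B \<and> cspan B = UNIV"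
    and A: "clinear A"
    and m: "m \<noteq> 0"
    and F_def: "F = cspan (f ` {1..m})"
    and V: "\<And>l. l \<in> cspectrum A \<Longrightarrow> is_direct_sum (V l) (range (minus_scalar A l))"
    and phi_def: "\<phi> = (\<lambda>(n, i). (A ^^ n) (f i))"
    and I_def: "I = {..<d} \<times> {1..m}"
  shows "(is_frame \<phi> I \<longleftrightarrow> is_complete_system \<phi> I)
    \<and> (is_frame \<phi> I \<longleftrightarrow>
         (\<forall>l\<in>cspectrum A. proj_along (V l) (range (minus_scalar A l)) ` F = V l))
    \<and> (is_frame \<phi> I \<longleftrightarrow>
         (\<forall>l\<in>cspectrum (cadjoint A).
            orth_proj (ker (minus_scalar (cadjoint A) l)) ` F = ker (minus_scalar (cadjoint A) l)))"

proof -
  obtain B :: "'a set" where B: "finite B" "card B = d" "\<not> cdependent B" "cspan B = UNIV"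
    using dim by blast
  interpret finite_dim_hilbert B
    by unfold_locales (fact B)+
  have "finite I"
    by (simp add: I_def)
  have "\<phi> ` I = {(A ^^ n) s | n s. n < card B \<and> s \<in> f ` {1..m}}"
    unfolding phi_def I_def B(2) by force
  then have "cspan (\<phi> ` I) = krylov A (f ` {1..m}) (card B)"
    by (simp add: krylov_def)
  then have frame: "is_frame \<phi> I \<longleftrightarrow>
      (\<forall>l\<in>cspectrum A. {v + w | v w. v \<in> F \<and> w \<in> range (minus_scalar A l)} = UNIV)"
    unfolding is_frame_iff_span[OF \<open>finite I\<close>] F_def by (simp add: krylov_eq_UNIV_iff[OF A])
  have "is_frame \<phi> I \<longleftrightarrow> is_complete_system \<phi> I"
    unfolding is_frame_iff_span[OF \<open>finite I\<close>] is_complete_system_iff_span ..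
  moreover have "is_frame \<phi> I \<longleftrightarrow>
      (\<forall>l\<in>cspectrum A. proj_along (V l) (range (minus_scalar A l)) ` F = V l)"
    unfolding frame by (intro ball_cong refl) (simp add: proj_along_image_eq_iff[OF V])
  moreover have "is_frame \<phi> I \<longleftrightarrow>
      (\<forall>l\<in>cspectrum (cadjoint A).
         orth_proj (ker (minus_scalar (cadjoint A) l)) ` F = ker (minus_scalar (cadjoint A) l))"
  proof -
    \<comment> \<open>This is the criterion of (ii) for the complement \<open>ker (A* - cnj l)\<close> of \<open>ran (A - l)\<close>.\<close>
    have orth: "orth_proj (ker (minus_scalar (cadjoint A) (cnj l))) ` F
          = ker (minus_scalar (cadjoint A) (cnj l)) \<longleftrightarrow>
        {v + w | v w. v \<in> F \<and> w \<in> range (minus_scalar A l)} = UNIV" for l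
    proof -
      have "csubspace (ker (minus_scalar (cadjoint A) (cnj l)))"
        unfolding ker_cadjoint[OF A] by (rule csubspace_orth_compl)
      from proj_along_image_eq_iff[OF is_direct_sum_orth_compl[OF this], of F] show ?thesis
        unfolding orth_proj_def orth_compl_ker_cadjoint[OF A] .
    qed
    have "(\<forall>l\<in>cspectrum (cadjoint A). P l) \<longleftrightarrow> (\<forall>l\<in>cspectrum A. P (cnj l))" for P
      using cnj_in_cspectrum_cadjoint[OF A] by (metis complex_cnj_cnj)
    then show ?thesis
      unfolding frame by (simp only: orth)
  qed
  ultimately show ?thesis
    by blast
qed

end
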